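(* Let $\mathbb{D}=\{z\in\mathbb{C} : |z|<1\}$ and let $f:\mathbb{D}\to\mathbb{D}$ be a holomorphic function such that: (i) $f\in V_F$, i.e. there exists a positive integer $N_f$ such that for every $w\in\mathbb{D}$ the set $\{z\in\mathbb{D} : f(z)=w\}$ has at most $N_f$ elements; (ii) $f'(z)\neq 0$ for all $z\in\mathbb{D}$; (iii) $f$ is an inner function. Then $f\in\mathrm{Aut}(\mathbb{D})$.
   Context: $V_F$ denotes the set of all holomorphic $f:\mathbb{D}\to\mathbb{D}$ for which there is a positive integer $N_f$ (depending on $f$) such that $d_f(w)=|\{z\in\mathbb{D} : f(z)=w\}|\le N_f$ for all $w\in\mathbb{D}$. A holomorphic $f:\mathbb{D}\to\mathbb{D}$ is an inner function if $\lim_{r\to 1^-}|f(re^{i\theta})|=1$ for almost every $\theta$ (with respect to Lebesgue measure). $\mathrm{Aut}(\mathbb{D})$ is the group of holomorphic automorphisms of $\mathbb{D}$, i.e. the maps $z\mapsto\lambda\frac{z-\alpha}{1-\overline{\alpha}z}$ with $\alpha\in\mathbb{D}$ and $|\lambda|=1$. *)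

theory Defs
  imports "HOL-Complex_Analysis.Complex_Analysis"
begin

text \<open>Functions \<open>\<complex> \<Rightarrow> \<complex>\<close> stand for functions on the disc; every notion below depends only
  on the values on the disc.\<close>

abbreviation unit_disc :: "complex set" where
  "unit_disc \<equiv> ball 0 1"

definition holo_self_maps :: "(complex \<Rightarrow> complex) set" where
  "holo_self_maps = {f. f holomorphic_on unit_disc \<and> f ` unit_disc \<subseteq> unit_disc}"

text \<open>Finiteness of the fibres is explicit because \<^const>\<open>card\<close> is 0 on infinite sets.\<close>

definition V_F :: "(complex \<Rightarrow> complex) set" where
  "V_F = {f \<in> holo_self_maps. \<exists>N::nat. N > 0 \<and>
     (\<forall>w\<in>unit_disc. finite {z \<in> unit_disc. f z = w} \<and> card {z \<in> unit_disc. f z = w} \<le> N)}"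

definition inner_function :: "(complex \<Rightarrow> complex) \<Rightarrow> bool" where
  "inner_function f \<longleftrightarrow> f \<in> holo_self_maps \<and>
     (AE \<theta> in lebesgue.
        ((\<lambda>r::real. cmod (f (of_real r * exp (\<i> * of_real \<theta>)))) \<longlongrightarrow> 1) (at_left 1))"

definition Aut_disc :: "(complex \<Rightarrow> complex) set" where
  "Aut_disc = {f. \<exists>c a. cmod c = 1 \<and> a \<in> unit_disc \<and>
     (\<forall>z\<in>unit_disc. f z = c * ((z - a) / (1 - cnj a * z)))}"

text \<open>These are exactly the biholomorphic self-maps of the disc.\<close>

lemma Aut_disc_iff_biholomorphic:
  "f \<in> Aut_disc \<longleftrightarrow> f \<in> holo_self_maps \<and>
     (\<exists>g\<in>holo_self_maps. \<forall>z\<in>unit_disc. g (f z) = z \<and> f (g z) = z)"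
proof
  assume "f \<in> Aut_disc"
  then obtain c a where c: "cmod c = 1" and a: "cmod a < 1"
    and f: "\<And>z. cmod z < 1 \<Longrightarrow> f z = c * Moebius_function 0 a z"
    by (auto simp: Aut_disc_def Moebius_function_simple)
  define g where "g = (\<lambda>w. Moebius_function 0 (-a) (inverse c * w))"
  have c0: "c \<noteq> 0" using c by auto
  have ci: "cmod (inverse c * w) = cmod w" for w using c by (simp add: norm_mult norm_inverse)
  have cm: "cmod (c * w) = cmod w" for w using c by (simp add: norm_mult)
  have "(\<lambda>z. c * Moebius_function 0 a z) holomorphic_on unit_disc"
    by (intro holomorphic_intros Moebius_function_holomorphic a)
  then have "f holomorphic_on unit_disc"
    by (rule holomorphic_transform) (simp add: f)
  moreover have f1: "cmod (f z) < 1" if "cmod z < 1" for z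
    using Moebius_function_norm_lt_1[OF a that] f[OF that] cm by simp
  moreover have "g holomorphic_on unit_disc"
  proof -
    have "(Moebius_function 0 (-a) \<circ> (\<lambda>w. inverse c * w)) holomorphic_on unit_disc"
      by (rule holomorphic_on_compose_gen[OF _ Moebius_function_holomorphic])
         (use a ci in \<open>auto intro!: holomorphic_intros\<close>)
    then show ?thesis by (simp add: g_def o_def)
  qed
  moreover have g1: "cmod (g z) < 1" if "cmod z < 1" for z
    using Moebius_function_norm_lt_1[of "-a" "inverse c * z"] a that ci by (simp add: g_def)
  moreover have "g (f z) = z" if "cmod z < 1" for z
    using Moebius_function_compose[of "-a" a z] a that f[OF that] c0
    by (simp add: g_def flip: mult.assoc)
  moreover have "f (g z) = z" if "cmod z < 1" for z
    using Moebius_function_compose[of a "-a" "inverse c * z"] a that f[OF g1[OF that]] c0 ci[of z]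
    by (simp add: g_def flip: mult.assoc)
  ultimately show "f \<in> holo_self_maps \<and>
     (\<exists>g\<in>holo_self_maps. \<forall>z\<in>unit_disc. g (f z) = z \<and> f (g z) = z)"
    by (auto simp: holo_self_maps_def intro!: bexI[of _ g])
next
  assume "f \<in> holo_self_maps \<and>
     (\<exists>g\<in>holo_self_maps. \<forall>z\<in>unit_disc. g (f z) = z \<and> f (g z) = z)"
  then obtain g where fh: "f holomorphic_on unit_disc" and gh: "g holomorphic_on unit_disc"
    and f1: "\<And>z. cmod z < 1 \<Longrightarrow> cmod (f z) < 1" and g1: "\<And>z. cmod z < 1 \<Longrightarrow> cmod (g z) < 1"
    and gf: "\<And>z. cmod z < 1 \<Longrightarrow> g (f z) = z" and fg: "\<And>z. cmod z < 1 \<Longrightarrow> f (g z) = z"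
    by (fastforce simp: holo_self_maps_def image_subset_iff)
  define a where "a = g 0"
  have a: "cmod a < 1" and a': "cmod (-a) < 1" using g1[of 0] by (auto simp: a_def)
  define h k where "h = f \<circ> Moebius_function 0 (-a)" and "k = Moebius_function 0 a \<circ> g"
  note M1 = Moebius_function_norm_lt_1[OF a, of _ 0] Moebius_function_norm_lt_1[OF a', of _ 0]
  have hh: "h holomorphic_on unit_disc" unfolding h_def
    by (rule holomorphic_on_compose_gen[OF Moebius_function_holomorphic[OF a'] fh]) (use M1 in auto)
  have kh: "k holomorphic_on unit_disc" unfolding k_def
    by (rule holomorphic_on_compose_gen[OF gh Moebius_function_holomorphic[OF a]]) (use g1 in auto)
  have h1: "cmod (h z) < 1" if "cmod z < 1" for z using that M1 f1 by (simp add: h_def)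
  have k1: "cmod (k z) < 1" if "cmod z < 1" for z using that M1 g1 by (simp add: k_def)
  have h0: "h 0 = 0" using fg[of 0] by (simp add: h_def a_def Moebius_function_of_zero)
  have k0: "k 0 = 0" by (simp add: k_def a_def Moebius_function_eq_zero)
  have kz: "k (h z) = z" if "cmod z < 1" for z
    using that M1 gf Moebius_function_compose[of a "-a" z] a by (simp add: h_def k_def)
  define p :: complex where "p = 1/2"
  have p: "cmod p < 1" "p \<noteq> 0" by (auto simp: p_def)
  have "cmod (h p) \<le> cmod p" by (rule Schwarz_Lemma(1)[OF hh h0 h1 p(1)])
  moreover have "cmod (k (h p)) \<le> cmod (h p)"
    by (rule Schwarz_Lemma(1)[OF kh k0 k1 h1[OF p(1)]])
  ultimately have "cmod (h p) = cmod p" using kz[OF p(1)] by simp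
  then obtain c where c: "\<And>z. cmod z < 1 \<Longrightarrow> h z = c * z" "cmod c = 1"
    using Schwarz_Lemma(3)[OF hh h0 h1 p(1)] p by blast
  have "f z = c * ((z - a) / (1 - cnj a * z))" if "cmod z < 1" for z
    using c(1)[OF M1(1)[OF that]] Moebius_function_compose[of "-a" a z] a that
    by (simp add: h_def Moebius_function_simple)
  with c(2) a show "f \<in> Aut_disc" by (auto simp: Aut_disc_def)
qed

end

theory Submission
  imports Defs "HOL-Real_Asymp.Real_Asymp"
begin

text \<open>Choose a point \<open>w\<close> whose fibre has the maximal number of elements. By the open mapping theorem
  all preimages of points near \<open>w\<close> lie near this fibre, so \<open>f - w\<close> is bounded away from \<open>0\<close> near the
  circle. Divide the Moebius transform \<open>(f - w) / (1 - cnj w * f)\<close> by the finite Blaschke product over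
  the (simple) zeros: the quotient \<open>G\<close> and its inverse are both bounded near the circle with
  unimodular radial limits almost everywhere, so \<open>\<bar>G\<bar> = 1\<close>, and hence \<open>\<bar>f\<bar> \<rightarrow> 1\<close> uniformly
  at the circle. Thus \<open>f\<close> is a proper local biholomorphism of the disc, that is, a covering of a simply
  connected space by a connected one, and so it is bijective.\<close>

section \<open>Uniform approach to the unit circle\<close>

text \<open>Only the modulus is prescribed, so a limit along this filter is uniform in the argument,
  unlike a radial limit; \<open>at_left 1\<close> keeps the points inside the disc.\<close>

abbreviation disc_bdry :: "complex filter" where
  "disc_bdry \<equiv> filtercomap cmod (at_left 1)"

lemma eventually_disc_bdry:
  "eventually P disc_bdry \<longleftrightarrow> (\<exists>b<1. \<forall>z. b < cmod z \<longrightarrow> cmod z < 1 \<longrightarrow> P z)"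
proof
  assume "eventually P disc_bdry"
  then show "\<exists>b<1. \<forall>z. b < cmod z \<longrightarrow> cmod z < 1 \<longrightarrow> P z"
    unfolding eventually_filtercomap eventually_at_left_field by blast
next
  assume "\<exists>b<1. \<forall>z. b < cmod z \<longrightarrow> cmod z < 1 \<longrightarrow> P z"
  then obtain b where "b < 1" "\<And>z. b < cmod z \<Longrightarrow> cmod z < 1 \<Longrightarrow> P z" by blast
  then show "eventually P disc_bdry"
    unfolding eventually_filtercomap eventually_at_left_field
    by (intro exI[of _ "\<lambda>x. b < x \<and> x < 1"]) auto
qed

lemma eventually_disc_bdry_less: "\<forall>\<^sub>F z in disc_bdry. cmod z < 1"
  unfolding eventually_disc_bdry by (rule exI[of _ 0]) auto

text \<open>Lets uniform boundary behaviour, such as that of a Blaschke product, be read off along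
  every radius.\<close>

lemma filterlim_radial_disc_bdry:
  "filterlim (\<lambda>r. of_real r * exp (\<i> * of_real \<theta>)) disc_bdry (at_left (1::real))"
proof -
  have "filterlim (\<lambda>r::real. r) (at_left 1) (at_left 1)"
    by (rule filterlim_ident)
  moreover have "\<forall>\<^sub>F r in at_left (1::real). r = \<bar>r\<bar>"
    unfolding eventually_at_left_field by (rule exI[of _ 0]) auto
  ultimately have "filterlim (\<lambda>r::real. \<bar>r\<bar>) (at_left 1) (at_left 1)"
    by (simp add: filterlim_cong)
  then show ?thesis
    by (simp add: filterlim_filtercomap_iff o_def norm_mult)
qed

section \<open>Moebius maps near the circle\<close>

text \<open>Rests on the identity |1 - cnj a u|^2 - |u - a|^2 = (1 - |a|^2)(1 - |u|^2) and on |1 -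
  cnj a u| >= 1 - |a|. The bound depends on \<open>u\<close> through its modulus alone, so it is
  uniform at the circle.\<close>

lemma power2_cmod_Moebius_ge:
  assumes a: "cmod a < 1" and u: "cmod u < 1"
  shows "1 - (1 - (cmod u)\<^sup>2) / (1 - cmod a)\<^sup>2 \<le> (cmod (Moebius_function 0 a u))\<^sup>2"
proof -
  have lower: "1 - cmod a \<le> cmod (1 - cnj a * u)"
  proof -
    have "cmod (cnj a * u) \<le> cmod a * 1"
      using u unfolding norm_mult complex_mod_cnj by (intro mult_left_mono) auto
    then show ?thesis
      using norm_triangle_ineq2[of 1 "cnj a * u"] by simp
  qed
  then have pos: "0 < cmod (1 - cnj a * u)" using a by linarith
  have "(cmod (1 - cnj a * u))\<^sup>2 - (cmod (u - a))\<^sup>2 = (1 - (cmod a)\<^sup>2) * (1 - (cmod u)\<^sup>2)"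
    unfolding cmod_power2 by (simp add: algebra_simps power2_eq_square)
  also have "\<dots> \<le> 1 * (1 - (cmod u)\<^sup>2)"
    using u by (intro mult_right_mono) (auto simp: power_le_one)
  finally have "(cmod (1 - cnj a * u))\<^sup>2 - (cmod (u - a))\<^sup>2 \<le> 1 - (cmod u)\<^sup>2" by simp
  then have "1 - (cmod (Moebius_function 0 a u))\<^sup>2 \<le> (1 - (cmod u)\<^sup>2) / (cmod (1 - cnj a * u))\<^sup>2"
    using pos by (simp add: Moebius_function_simple norm_divide divide_simps)
  also have "\<dots> \<le> (1 - (cmod u)\<^sup>2) / (1 - cmod a)\<^sup>2"
    using u a lower by (intro divide_left_mono power_mono mult_pos_pos zero_less_power pos)
      (auto simp: power_le_one)
  finally show ?thesis by simp
qed

text \<open>A general filter and a general \<open>u\<close> serve three purposes: the Blaschke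
  factors with \<open>u\<close> the identity, the transform of an inner function along radii, and
  the inverse transform that recovers the function at the end.\<close>

lemma tendsto_cmod_Moebius:
  assumes a: "cmod a < 1" and u: "\<forall>\<^sub>F x in F. cmod (u x) < 1"
    and lim: "((\<lambda>x. cmod (u x)) \<longlongrightarrow> 1) F"
  shows "((\<lambda>x. cmod (Moebius_function 0 a (u x))) \<longlongrightarrow> 1) F"
proof (rule tendsto_sandwich)
  show "\<forall>\<^sub>F x in F. 1 - (1 - (cmod (u x))\<^sup>2) / (1 - cmod a)\<^sup>2 \<le> cmod (Moebius_function 0 a (u x))"
    using u
  proof eventually_elim
    case (elim x)
    \<comment> \<open>The available bound is for the square; as the modulus is below 1, its square
      lies below it.\<close>
    have "(cmod (Moebius_function 0 a (u x)))\<^sup>2 \<le> cmod (Moebius_function 0 a (u x))"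
      using Moebius_function_norm_lt_1[OF a elim, of 0]
      by (simp add: power2_eq_square mult_left_le)
    with power2_cmod_Moebius_ge[OF a elim] show ?case by linarith
  qed
  show "\<forall>\<^sub>F x in F. cmod (Moebius_function 0 a (u x)) \<le> 1"
    using u by eventually_elim (use Moebius_function_norm_lt_1[OF a] in \<open>auto intro: less_imp_le\<close>)
  have "((\<lambda>x. 1 - (1 - (cmod (u x))\<^sup>2) / (1 - cmod a)\<^sup>2) \<longlongrightarrow> 1 - (1 - 1\<^sup>2) / (1 - cmod a)\<^sup>2) F"
    using a by (intro tendsto_intros lim) auto
  then show "((\<lambda>x. 1 - (1 - (cmod (u x))\<^sup>2) / (1 - cmod a)\<^sup>2) \<longlongrightarrow> 1) F" by simp
qed auto

section \<open>Bounded functions with unimodular radial limits\<close>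

text \<open>In Cauchy's formula the kernel is at most \<open>r / (r - cmod z)\<close>. This factor
  is the same for every \<open>h\<close>, hence does not grow when \<open>h\<close> is replaced by
  its powers.\<close>

lemma Cauchy_estimate_circle:
  assumes h: "h holomorphic_on cball 0 r" and z: "cmod z < r"
  shows "2 * pi * cmod (h z) \<le> integral {0..2*pi} (\<lambda>t. cmod (h (of_real r * cis t))) * (r / (r - cmod z))"
proof -
  have r: "0 < r" using z norm_ge_zero[of z] by linarith
  have "((\<lambda>u. h u / (u - z)) has_contour_integral (2 * of_real pi * \<i> * h z)) (circlepath 0 r)"
    by (rule Cauchy_integral_circlepath_simple) (use assms in auto)
  then have I: "((\<lambda>t. h (r * cis t) / (r * cis t - z) * r * \<i> * cis t) has_integral
      (2 * of_real pi * \<i> * h z)) {0..2*pi}"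
    by (simp add: circlepath_def has_contour_integral_part_circlepath_iff)
  have cont: "continuous_on {0..2*pi} (\<lambda>t. cmod (h (of_real r * cis t)))"
    using r by (intro continuous_intros continuous_on_compose2[OF holomorphic_on_imp_continuous_on[OF h]])
      (auto simp: norm_mult)
  have "2 * pi * cmod (h z) = cmod (integral {0..2*pi} (\<lambda>t. h (r * cis t) / (r * cis t - z) * r * \<i> * cis t))"
    unfolding integral_unique[OF I] by (simp add: norm_mult)
  also have "\<dots> \<le> integral {0..2*pi} (\<lambda>t. cmod (h (of_real r * cis t)) * (r / (r - cmod z)))"
  proof (rule integral_norm_bound_integral)
    show "(\<lambda>t. h (r * cis t) / (r * cis t - z) * r * \<i> * cis t) integrable_on {0..2*pi}"
      using I by blast
    show "(\<lambda>t. cmod (h (of_real r * cis t)) * (r / (r - cmod z))) integrable_on {0..2*pi}"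
      by (intro integrable_continuous_interval continuous_intros cont)
    fix t :: real
    have "r - cmod z \<le> cmod (r * cis t - z)"
      using norm_triangle_ineq2[of "r * cis t" z] r by (simp add: norm_mult)
    then have "r / cmod (r * cis t - z) \<le> r / (r - cmod z)"
      using z r by (intro divide_left_mono mult_pos_pos) auto
    then have "cmod (h (r * cis t)) * (r / cmod (r * cis t - z)) \<le> cmod (h (r * cis t)) * (r / (r - cmod z))"
      by (rule mult_left_mono) auto
    then show "cmod (h (r * cis t) / (r * cis t - z) * r * \<i> * cis t)
        \<le> cmod (h (of_real r * cis t)) * (r / (r - cmod z))"
      using r by (simp add: norm_mult norm_divide)
  qed
  finally show ?thesis by simp
qed

text \<open>Cauchy's formula for \<open>h ^ n\<close> gives \<open>\<bar>h z\<bar> ^ n \<le> 1 / (1 - \<bar>z\<bar>)\<close> for all \<open>n\<close>, so no Poisson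
  kernel is needed.\<close>

lemma cmod_le_one_if_radial_limits:
  assumes h: "h holomorphic_on unit_disc"
    and M: "\<forall>\<^sub>F w in disc_bdry. cmod (h w) \<le> M"
    and lim: "AE \<theta> in lebesgue.
      ((\<lambda>r::real. cmod (h (of_real r * exp (\<i> * of_real \<theta>)))) \<longlongrightarrow> 1) (at_left 1)"
    and z: "cmod z < 1"
  shows "cmod (h z) \<le> 1"
proof -
  obtain b where b: "b < 1" "\<And>w. b < cmod w \<Longrightarrow> cmod w < 1 \<Longrightarrow> cmod (h w) \<le> M"
    using M unfolding eventually_disc_bdry by blast
  obtain N where "N \<in> null_sets lebesgue" and N:
    "\<And>\<theta>. \<theta> \<notin> N \<Longrightarrow> ((\<lambda>r::real. cmod (h (of_real r * exp (\<i> * of_real \<theta>)))) \<longlongrightarrow> 1) (at_left 1)"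
    by (rule AE_E3[OF lim]) auto
  then have "negligible N" by (simp add: negligible_iff_null_sets)
  \<comment> \<open>On circles of radius between \<open>c\<close> and 1 the bound \<open>M\<close>
    holds, and they enclose \<open>z\<close>.\<close>
  define c where "c = max b (cmod z)"
  have c: "c < 1" "b \<le> c" "cmod z \<le> c" "0 \<le> c"
    using b z norm_ge_zero[of z] by (auto simp: c_def simp del: norm_ge_zero)
  \<comment> \<open>The shift by 2 makes already \<open>r 0\<close> exceed \<open>c\<close>
    strictly.\<close>
  define r where "r k = 1 - (1 - c) / real (k + 2)" for k
  have r: "c < r k" "r k < 1" for k
  proof -
    have "(1 - c) * 1 < (1 - c) * real (k + 2)" using c by (intro mult_strict_left_mono) auto
    then have "(1 - c) / real (k + 2) < 1 - c" using c by (simp add: field_simps)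
    then show "c < r k" by (simp add: r_def)
    show "r k < 1" using c by (simp add: r_def)
  qed
  have rlim: "r \<longlonglongrightarrow> 1"
    unfolding r_def by real_asymp
  then have rleft: "filterlim r (at_left 1) sequentially"
    using r by (auto simp: filterlim_at less_imp_neq)
  have rz: "cmod z < r k" "0 < r k" for k using r(1)[of k] c(3,4) by linarith+
  \<comment> \<open>Pointwise limits are available only off \<open>N\<close>; integrals over
    \<open>S\<close> and over the full period agree because \<open>N\<close> is negligible.\<close>
  define S where "S = {0..2*pi} - N"
  have "cmod (h z) ^ n \<le> 1 / (1 - cmod z)" for n
  proof -
    define \<phi> where "\<phi> k t = cmod (h (of_real (r k) * cis t) ^ n)" for k t
    have cont: "continuous_on {0..2*pi} (\<phi> k)" for k
      unfolding \<phi>_def using r[of k] rz[of k]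
      by (intro continuous_intros continuous_on_compose2[OF holomorphic_on_imp_continuous_on[OF h]])
        (auto simp: norm_mult)
    have spike: "negligible {x \<in> {0..2*pi} - S. F x \<noteq> 0}" "negligible {x \<in> S - {0..2*pi}. F x \<noteq> 0}"
      for F :: "real \<Rightarrow> real"
      by (rule negligible_subset[OF \<open>negligible N\<close>], auto simp: S_def)+
    have int: "\<phi> k integrable_on S" for k
      by (rule integrable_spike_set[OF integrable_continuous_interval[OF cont] spike])
    have one: "(\<lambda>_. 1::real) integrable_on S"
      by (rule integrable_spike_set[OF _ spike]) (rule integrable_const_ivl)
    have "(\<lambda>k. integral S (\<phi> k)) \<longlonglongrightarrow> integral S (\<lambda>_. 1)"
    \<comment> \<open>All these circles lie where \<open>M\<close> bounds \<open>h\<close>, so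
      \<open>M ^ n\<close> dominates every integrand.\<close>
    proof (rule dominated_convergence(2)[where h = "\<lambda>_. M ^ n"])
      show "\<phi> k integrable_on S" for k by (rule int)
      show "(\<lambda>_. M ^ n) integrable_on S"
        by (rule integrable_spike_set[OF _ spike]) (rule integrable_const_ivl)
      show "norm (\<phi> k t) \<le> M ^ n" for k t
        using b(2)[of "r k * cis t"] r[of k] rz[of k] c
        by (auto simp: \<phi>_def norm_mult norm_power intro!: power_mono)
      show "(\<lambda>k. \<phi> k t) \<longlonglongrightarrow> 1" if "t \<in> S" for t
      proof -
        have "(\<lambda>k. cmod (h (of_real (r k) * exp (\<i> * of_real t)))) \<longlonglongrightarrow> 1"
          by (rule filterlim_compose[OF N rleft]) (use that in \<open>auto simp: S_def\<close>)
        from tendsto_power[OF this, of n] show ?thesis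
          by (simp add: \<phi>_def norm_power cis_conv_exp)
      qed
    qed
    moreover have "integral S F = integral {0..2*pi} F" for F :: "real \<Rightarrow> real"
      by (rule integral_spike_set[OF spike(2,1)])
    ultimately have "(\<lambda>k. integral {0..2*pi} (\<phi> k)) \<longlonglongrightarrow> 2 * pi" by simp
    then have "(\<lambda>k. integral {0..2*pi} (\<phi> k) * (r k / (r k - cmod z))) \<longlonglongrightarrow> 2 * pi * (1 / (1 - cmod z))"
      using z by (intro tendsto_intros rlim) auto
    moreover have "2 * pi * cmod (h z ^ n) \<le> integral {0..2*pi} (\<phi> k) * (r k / (r k - cmod z))" for k
      unfolding \<phi>_def
      by (rule Cauchy_estimate_circle)
        (use r[of k] rz[of k] in \<open>auto intro!: holomorphic_intros holomorphic_on_subset[OF h]\<close>)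
    ultimately have "2 * pi * cmod (h z ^ n) \<le> 2 * pi * (1 / (1 - cmod z))"
      by (intro LIMSEQ_le_const) auto
    then have "cmod (h z ^ n) \<le> 1 / (1 - cmod z)"
      by (rule mult_left_le_imp_le) simp
    then show ?thesis by (simp only: norm_power)
  qed
  moreover have "\<exists>n. 1 / (1 - cmod z) < cmod (h z) ^ n" if "1 < cmod (h z)"
    by (rule real_arch_pow[OF that])
  ultimately show ?thesis by (meson not_le)
qed

section \<open>Splitting off the zeros of an inner function\<close>

text \<open>Induction on the zero set: dividing by \<open>z - a\<close> removes the simple zero at
  \<open>a\<close>, and multiplying the cofactor by the zero-free \<open>1 - cnj a * z\<close> turns
  the linear factor into a Moebius one.\<close>

lemma holomorphic_factor_simple_zeros:
  assumes "finite S" "S \<subseteq> unit_disc" "f holomorphic_on unit_disc"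
    and "\<And>z. z \<in> unit_disc \<Longrightarrow> f z = 0 \<longleftrightarrow> z \<in> S"
    and "\<And>z. z \<in> S \<Longrightarrow> deriv f z \<noteq> 0"
  obtains g where "g holomorphic_on unit_disc" "\<And>z. z \<in> unit_disc \<Longrightarrow> g z \<noteq> 0"
    "\<And>z. z \<in> unit_disc \<Longrightarrow> f z = (\<Prod>a\<in>S. Moebius_function 0 a z) * g z"
proof -
  have "\<exists>g. g holomorphic_on unit_disc \<and> (\<forall>z\<in>unit_disc. g z \<noteq> 0 \<and>
      f z = (\<Prod>a\<in>S. Moebius_function 0 a z) * g z)"
    using assms
  proof (induction S arbitrary: f rule: finite_induct)
    case empty
    then show ?case by auto
  next
    case (insert a S)
    have a: "cmod a < 1" "a \<in> unit_disc" and S: "S \<subseteq> unit_disc" and hf: "f holomorphic_on unit_disc"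
      and fz: "\<And>z. z \<in> unit_disc \<Longrightarrow> f z = 0 \<longleftrightarrow> z = a \<or> z \<in> S"
      and df: "deriv f a \<noteq> 0" "\<And>z. z \<in> S \<Longrightarrow> deriv f z \<noteq> 0"
      using insert.prems by auto
    have fa: "f a = 0" using fz a by auto
    \<comment> \<open>The singularity at \<open>a\<close> is removable; the value filled in is the
      derivative, nonzero as the zero is simple, so \<open>a\<close> is no zero of
      \<open>q\<close>.\<close>
    define q where "q = (\<lambda>z. if z = a then deriv f a else (f z - f a) / (z - a))"
    have hq: "q holomorphic_on unit_disc"
      unfolding q_def by (rule pole_lemma_open[OF hf open_ball])
    have fq: "f z = (z - a) * q z" for z
      by (simp add: q_def fa)
    have qz: "q z = 0 \<longleftrightarrow> z \<in> S" if "z \<in> unit_disc" for z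
    proof (cases "z = a")
      case True
      then show ?thesis using df(1) insert.hyps by (simp add: q_def)
    next
      case False
      then show ?thesis using fz[OF that] by (simp add: q_def fa)
    qed
    have dq: "deriv q z \<noteq> 0" if "z \<in> S" for z
    proof -
      have "q field_differentiable at z"
        using that S by (intro holomorphic_on_imp_differentiable_at[OF hq]) auto
      \<comment> \<open>At a zero of \<open>q\<close> the second term of the product rule vanishes,
        so simplicity passes from \<open>f\<close> to \<open>q\<close>.\<close>
      then have "((\<lambda>z. (z - a) * q z) has_field_derivative (z - a) * deriv q z + 1 * q z) (at z)"
        by (auto intro!: derivative_eq_intros simp: field_differentiable_derivI)
      then have "deriv f z = (z - a) * deriv q z"
        using qz[of z] that S by (subst fq[abs_def]) (auto intro!: DERIV_imp_deriv)
      with df(2)[OF that] show ?thesis by auto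
    qed
    obtain g where g: "g holomorphic_on unit_disc" "\<And>z. z \<in> unit_disc \<Longrightarrow> g z \<noteq> 0"
      "\<And>z. z \<in> unit_disc \<Longrightarrow> q z = (\<Prod>a\<in>S. Moebius_function 0 a z) * g z"
      using insert.IH[OF S hq qz dq] by blast
    have nz: "1 - cnj a * z \<noteq> 0" if "z \<in> unit_disc" for z
    proof
      assume "1 - cnj a * z = 0"
      then have "cmod (cnj a * z) = 1" by simp
      moreover have "cmod a * cmod z < 1 * 1"
        using a that by (intro mult_strict_mono') auto
      ultimately show False by (simp add: norm_mult)
    qed
    show ?case
    proof (intro exI[of _ "\<lambda>z. (1 - cnj a * z) * g z"] conjI ballI)
      show "(\<lambda>z. (1 - cnj a * z) * g z) holomorphic_on unit_disc"
        by (intro holomorphic_intros g)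
      fix z assume z: "z \<in> unit_disc"
      show "(1 - cnj a * z) * g z \<noteq> 0" using nz[OF z] g(2)[OF z] by simp
      show "f z = (\<Prod>a\<in>insert a S. Moebius_function 0 a z) * ((1 - cnj a * z) * g z)"
        using insert.hyps nz[OF z] by (simp add: fq[of z] g(3)[OF z] Moebius_function_simple)
    qed
  qed
  then show ?thesis using that by blast
qed

text \<open>A bounded zero-free quotient with unimodular radial limits need not be unimodular: a
  singular inner factor could remain. The hypothesis \<open>away\<close> excludes this, since it
  bounds the inverse of the quotient \<open>G\<close> near the circle as well.\<close>

lemma inner_function_tendsto_boundary:
  assumes hf: "f holomorphic_on unit_disc" and f1: "\<And>z. cmod z < 1 \<Longrightarrow> cmod (f z) < 1"
    and lim: "AE \<theta> in lebesgue.
      ((\<lambda>r::real. cmod (f (of_real r * exp (\<i> * of_real \<theta>)))) \<longlongrightarrow> 1) (at_left 1)"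
    and w: "cmod w < 1"
    and fin: "finite {z \<in> unit_disc. f z = w}"
    and simple: "\<And>z. cmod z < 1 \<Longrightarrow> f z = w \<Longrightarrow> deriv f z \<noteq> 0"
    and away: "\<rho> > 0" "\<forall>\<^sub>F z in disc_bdry. \<rho> \<le> cmod (f z - w)"
  shows "((\<lambda>z. cmod (f z)) \<longlongrightarrow> 1) disc_bdry"
proof -
  define S where "S = {z \<in> unit_disc. f z = w}"
  define B where "B z = (\<Prod>a\<in>S. Moebius_function 0 a z)" for z
  define F where "F z = Moebius_function 0 w (f z)" for z
  have F1: "cmod (F z) < 1" if "cmod z < 1" for z
    unfolding F_def by (rule Moebius_function_norm_lt_1[OF w f1[OF that]])
  have "deriv (\<lambda>z. f z - w) z = deriv f z" if "z \<in> S" for z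
  proof -
    have "f field_differentiable at z"
      using that by (intro holomorphic_on_imp_differentiable_at[OF hf]) (auto simp: S_def)
    then show ?thesis by simp
  qed
  then have "deriv (\<lambda>z. f z - w) z \<noteq> 0" if "z \<in> S" for z
    using simple that by (auto simp: S_def)
  moreover have "finite S" "S \<subseteq> unit_disc" "(\<lambda>z. f z - w) holomorphic_on unit_disc"
    "\<And>z. z \<in> unit_disc \<Longrightarrow> f z - w = 0 \<longleftrightarrow> z \<in> S"
    using fin by (auto simp: S_def intro!: holomorphic_intros hf)
  ultimately obtain g where g: "g holomorphic_on unit_disc" "\<And>z. z \<in> unit_disc \<Longrightarrow> g z \<noteq> 0"
    "\<And>z. z \<in> unit_disc \<Longrightarrow> f z - w = B z * g z"
    unfolding B_def using holomorphic_factor_simple_zeros[of S "\<lambda>z. f z - w"] by metis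
  have den: "1 - cnj w * f z \<noteq> 0" "cmod (1 - cnj w * f z) \<le> 2" if "cmod z < 1" for z
  proof -
    have *: "cmod (cnj w * f z) < 1"
      using mult_strict_mono'[OF w f1[OF that]] by (simp add: norm_mult)
    then show "1 - cnj w * f z \<noteq> 0" by auto
    show "cmod (1 - cnj w * f z) \<le> 2"
      using norm_triangle_ineq4[of 1 "cnj w * f z"] * by simp
  qed
  \<comment> \<open>\<open>G\<close> absorbs the Moebius denominator, so that \<open>F\<close> is
    \<open>B\<close> times \<open>G\<close> on the disc.\<close>
  define G where "G z = g z / (1 - cnj w * f z)" for z
  have hG: "G holomorphic_on unit_disc"
    unfolding G_def using den by (intro holomorphic_intros g hf) auto
  have G0: "G z \<noteq> 0" if "cmod z < 1" for z using g(2)[of z] den[OF that] that by (simp add: G_def)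
  have hG': "(\<lambda>z. inverse (G z)) holomorphic_on unit_disc"
    using G0 by (intro holomorphic_intros hG) auto
  have FG: "cmod (F z) = cmod (B z) * cmod (G z)" if "cmod z < 1" for z
    using g(3)[of z] that by (simp add: F_def G_def Moebius_function_simple norm_mult norm_divide)
  have Blim: "((\<lambda>z. cmod (B z)) \<longlongrightarrow> 1) disc_bdry"
  proof -
    have "((\<lambda>z. cmod z) \<longlongrightarrow> 1) disc_bdry"
      using filterlim_filtercomap[of cmod "at_left 1"] by (auto simp: filterlim_at)
    then have "((\<lambda>z. \<Prod>a\<in>S. cmod (Moebius_function 0 a z)) \<longlongrightarrow> (\<Prod>a\<in>S. 1)) disc_bdry"
      by (intro tendsto_prod tendsto_cmod_Moebius eventually_disc_bdry_less) (auto simp: S_def)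
    then show ?thesis by (simp add: B_def prod_norm)
  qed
  \<comment> \<open>Any constant strictly between 0 and 1 would do; it yields a bound on
    \<open>G\<close> near the circle.\<close>
  then have Bhalf: "\<forall>\<^sub>F z in disc_bdry. 1/2 < cmod (B z)"
    by (rule order_tendstoD) simp
  have B1: "cmod (B z) \<le> 1" if "cmod z < 1" for z
    unfolding B_def prod_norm[symmetric]
    using Moebius_function_norm_lt_1 that by (intro prod_le_1) (auto simp: S_def intro: less_imp_le)
  have radial: "AE \<theta> in lebesgue. ((\<lambda>r::real. cmod (G (of_real r * exp (\<i> * of_real \<theta>)))) \<longlongrightarrow> 1) (at_left 1)"
    using lim
  proof eventually_elim
    case (elim \<theta>)
    let ?e = "\<lambda>r::real. of_real r * exp (\<i> * of_real \<theta>)"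
    have e: "\<forall>\<^sub>F r in at_left (1::real). cmod (?e r) < 1" 
      using filterlim_radial_disc_bdry eventually_disc_bdry_less by (rule eventually_compose_filterlim[rotated])
    then have "\<forall>\<^sub>F r in at_left (1::real). cmod (f (?e r)) < 1"
      by eventually_elim (rule f1)
    then have "((\<lambda>r. cmod (F (?e r))) \<longlongrightarrow> 1) (at_left 1)"
      unfolding F_def using elim by (intro tendsto_cmod_Moebius w)
    moreover have Be: "((\<lambda>r. cmod (B (?e r))) \<longlongrightarrow> 1) (at_left 1)"
      by (rule filterlim_compose[OF Blim filterlim_radial_disc_bdry])
    ultimately have "((\<lambda>r. cmod (F (?e r)) / cmod (B (?e r))) \<longlongrightarrow> 1 / 1) (at_left 1)"
      by (intro tendsto_divide) auto
    \<comment> \<open>\<open>B\<close> may vanish at interior points of the radius, but not close to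
      its end, so the division is legitimate there.\<close>
    moreover have "\<forall>\<^sub>F r in at_left (1::real). cmod (F (?e r)) / cmod (B (?e r)) = cmod (G (?e r))"
      using e order_tendstoD(1)[OF Be, of 0, simplified] by eventually_elim (simp add: FG)
    ultimately show ?case using tendsto_cong by force
  qed
  have "\<forall>\<^sub>F z in disc_bdry. cmod (G z) \<le> 2"
    using Bhalf eventually_disc_bdry_less
  proof eventually_elim
    case (elim z)
    have "1/2 * cmod (G z) \<le> cmod (B z) * cmod (G z)"
      using elim by (intro mult_right_mono) auto
    then show ?case using F1[OF elim(2)] FG[OF elim(2)] by simp
  qed
  then have G1: "cmod (G z) \<le> 1" if "cmod z < 1" for z
    using cmod_le_one_if_radial_limits[OF hG _ radial that] by blast
  have "\<forall>\<^sub>F z in disc_bdry. cmod (inverse (G z)) \<le> 2 / \<rho>"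
    using away(2) eventually_disc_bdry_less
  proof eventually_elim
    case (elim z)
    \<comment> \<open>The numerator is at least \<open>\<rho>\<close> by \<open>away\<close>, and
      the denominator is at most 2.\<close>
    have "\<rho> / 2 \<le> cmod (f z - w) / cmod (1 - cnj w * f z)"
      using elim den[OF elim(2)] away(1) by (intro frac_le) auto
    also have "\<dots> = cmod (F z)" by (simp add: F_def Moebius_function_simple norm_divide)
    also have "\<dots> \<le> 1 * cmod (G z)"
      unfolding FG[OF elim(2)] by (intro mult_right_mono B1 elim) auto
    finally have "inverse (cmod (G z)) \<le> inverse (\<rho> / 2)"
      using away(1) by (intro le_imp_inverse_le) auto
    then show ?case by (simp add: norm_inverse)
  qed
  moreover have "AE \<theta> in lebesgue.
      ((\<lambda>r::real. cmod (inverse (G (of_real r * exp (\<i> * of_real \<theta>))))) \<longlongrightarrow> 1) (at_left 1)"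
    using radial
  proof eventually_elim
    case (elim \<theta>)
    from tendsto_inverse[OF this] show ?case by (simp add: norm_inverse)
  qed
  ultimately have "cmod (inverse (G z)) \<le> 1" if "cmod z < 1" for z
    using cmod_le_one_if_radial_limits[OF hG' _ _ that] by blast
  then have "1 \<le> cmod (G z)" if "cmod z < 1" for z
    using that G0[OF that] inverse_le_1_iff[of "cmod (G z)"] by (fastforce simp: norm_inverse)
  then have "cmod (G z) = 1" if "cmod z < 1" for z
    using G1[OF that] that by (simp add: order_antisym)
  then have FB: "cmod (F z) = cmod (B z)" if "cmod z < 1" for z
    using FG that by simp
  have "((\<lambda>z. cmod (F z)) \<longlongrightarrow> 1) disc_bdry"
    by (rule Lim_transform_eventually[OF Blim])
      (use eventually_disc_bdry_less in eventually_elim, simp add: FB)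
  \<comment> \<open>The Moebius map with parameter \<open>-w\<close> inverts the one with parameter
    \<open>w\<close>, which carries the limit from \<open>F\<close> back to
    \<open>f\<close>.\<close>
  then have "((\<lambda>z. cmod (Moebius_function 0 (-w) (F z))) \<longlongrightarrow> 1) disc_bdry"
    using w by (intro tendsto_cmod_Moebius eventually_mono[OF eventually_disc_bdry_less F1]) auto
  moreover have "\<forall>\<^sub>F z in disc_bdry. cmod (Moebius_function 0 (-w) (F z)) = cmod (f z)"
    using eventually_disc_bdry_less
    by eventually_elim (use w f1 in \<open>simp add: F_def Moebius_function_compose\<close>)
  ultimately show ?thesis
    by (rule Lim_transform_eventually)
qed

section \<open>Counting preimages near a maximal fibre\<close>

text \<open>Phrased for all small radii rather than for one, so that it combines with further
  smallness conditions without taking minima.\<close>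

lemma eventually_separated_cballs:
  fixes D :: "'a::metric_space set"
  assumes "finite T" "T \<subseteq> D" "open D"
  shows "\<forall>\<^sub>F \<delta> in at_right 0. (\<forall>z\<in>T. cball z \<delta> \<subseteq> D) \<and>
    (\<forall>z\<in>T. \<forall>w\<in>T. z \<noteq> w \<longrightarrow> cball z \<delta> \<inter> cball w \<delta> = {})"
proof (intro eventually_conj eventually_ball_finite assms ballI)
  fix z assume "z \<in> T"
  then obtain e where e: "e > 0" "cball z e \<subseteq> D"
    using assms open_contains_cball by blast
  then have "\<forall>\<^sub>F \<delta> in at_right 0. \<delta> < e"
    unfolding eventually_at_right_field by blast
  then show "\<forall>\<^sub>F \<delta> in at_right 0. cball z \<delta> \<subseteq> D"
    by eventually_elim (rule order_trans[OF subset_cball e(2)], simp)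
  fix w
  show "\<forall>\<^sub>F \<delta> in at_right 0. z \<noteq> w \<longrightarrow> cball z \<delta> \<inter> cball w \<delta> = {}"
  proof (cases "z = w")
    case False
    then have "\<forall>\<^sub>F \<delta> in at_right 0. \<delta> < dist z w / 2"
      unfolding eventually_at_right_field by (intro exI[of _ "dist z w / 2"]) auto
    then show ?thesis
      by eventually_elim (auto intro!: disjoint_cballI)
  qed auto
qed

lemma locally_injective_separated_balls:
  assumes hf: "f holomorphic_on D" and D: "open D" and T: "finite T" "T \<subseteq> D"
    and df: "\<And>z. z \<in> T \<Longrightarrow> deriv f z \<noteq> 0"
  obtains \<delta> where "\<delta> > 0" "\<And>z. z \<in> T \<Longrightarrow> cball z \<delta> \<subseteq> D" "\<And>z. z \<in> T \<Longrightarrow> inj_on f (ball z \<delta>)"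
    "\<And>z w. z \<in> T \<Longrightarrow> w \<in> T \<Longrightarrow> z \<noteq> w \<Longrightarrow> cball z \<delta> \<inter> cball w \<delta> = {}"
proof -
  have "\<forall>\<^sub>F \<delta> in at_right 0. \<forall>z\<in>T. inj_on f (ball z \<delta>)"
  proof (intro eventually_ball_finite T ballI)
    fix z assume "z \<in> T"
    then obtain r where r: "r > 0" "inj_on f (ball z r)"
      using has_complex_derivative_locally_injective[OF hf _ D df] T by blast
    then have "\<forall>\<^sub>F \<delta> in at_right 0. \<delta> < r"
      unfolding eventually_at_right_field by blast
    then show "\<forall>\<^sub>F \<delta> in at_right 0. inj_on f (ball z \<delta>)"
      by eventually_elim (rule inj_on_subset[OF r(2)], simp add: subset_ball)
  qed
  moreover have "\<forall>\<^sub>F \<delta> in at_right (0::real). 0 < \<delta>"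
    by (rule eventually_at_right_less)
  ultimately have "\<forall>\<^sub>F \<delta> in at_right 0. 0 < \<delta> \<and> (\<forall>z\<in>T. inj_on f (ball z \<delta>)) \<and>
      (\<forall>z\<in>T. cball z \<delta> \<subseteq> D) \<and> (\<forall>z\<in>T. \<forall>w\<in>T. z \<noteq> w \<longrightarrow> cball z \<delta> \<inter> cball w \<delta> = {})"
    using eventually_separated_cballs[OF T D] by (simp only: eventually_conj_iff simp_thms)
  from eventually_happens'[OF trivial_limit_at_right_real this]
  obtain \<delta> where "0 < \<delta>" "\<forall>z\<in>T. inj_on f (ball z \<delta>)" "\<forall>z\<in>T. cball z \<delta> \<subseteq> D"
    "\<forall>z\<in>T. \<forall>w\<in>T. z \<noteq> w \<longrightarrow> cball z \<delta> \<inter> cball w \<delta> = {}"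
    by (elim exE conjE)
  then show thesis by (intro that[of \<delta>]) simp_all
qed

text \<open>Each small ball around a point of \<open>T\<close> contributes a preimage of every value
  near \<open>w\<close>. These are already \<open>card T\<close> many, so maximality leaves no room
  for one outside the balls.\<close>

lemma compact_preimage_near_maximal_fibre:
  assumes hf: "f holomorphic_on D" and D: "open D" and T: "finite T" "T = {z \<in> D. f z = w}"
    and df: "\<And>z. z \<in> T \<Longrightarrow> deriv f z \<noteq> 0"
    and E: "open E" "w \<in> E"
    and max: "\<And>v. v \<in> E \<Longrightarrow> finite {z \<in> D. f z = v} \<and> card {z \<in> D. f z = v} \<le> card T"
  obtains \<rho> K where "\<rho> > 0" "compact K" "K \<subseteq> D" "\<And>z. z \<in> D \<Longrightarrow> dist (f z) w < \<rho> \<Longrightarrow> z \<in> K"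
proof -
  have TD: "T \<subseteq> D" using T by auto
  obtain \<delta> where \<delta>: "\<delta> > 0" "\<And>z. z \<in> T \<Longrightarrow> cball z \<delta> \<subseteq> D" "\<And>z. z \<in> T \<Longrightarrow> inj_on f (ball z \<delta>)"
    "\<And>z w. z \<in> T \<Longrightarrow> w \<in> T \<Longrightarrow> z \<noteq> w \<Longrightarrow> cball z \<delta> \<inter> cball w \<delta> = {}"
    using locally_injective_separated_balls[OF hf D T(1) TD df] by metis
  have ballD: "ball z \<delta> \<subseteq> D" if "z \<in> T" for z
    using \<delta>(2)[OF that] ball_subset_cball by blast
  \<comment> \<open>Values taken in every one of the balls; injectivity on the balls makes their
    images open.\<close>
  define V where "V = E \<inter> (\<Inter>z\<in>T. f ` ball z \<delta>)"
  have "open V"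
    unfolding V_def using T(1) E(1) \<delta>(3) ballD
    by (intro open_Int open_INT ballI open_mapping_thm3) (auto intro: holomorphic_on_subset[OF hf])
  moreover have "w \<in> V"
  proof -
    have "w \<in> f ` ball z \<delta>" if "z \<in> T" for z
      using that T(2) \<delta>(1) by (intro image_eqI[of _ _ z]) auto
    then show ?thesis using E(2) by (simp add: V_def)
  qed
  ultimately obtain \<rho> where \<rho>: "\<rho> > 0" "ball w \<rho> \<subseteq> V"
    using open_contains_ball by blast
  show thesis
  proof (rule that[of \<rho> "\<Union>z\<in>T. cball z \<delta>"])
    show "compact (\<Union>z\<in>T. cball z \<delta>)" using T(1) by (intro compact_UN) auto
    show "(\<Union>z\<in>T. cball z \<delta>) \<subseteq> D" using \<delta>(2) by auto
    fix x assume x: "x \<in> D" "dist (f x) w < \<rho>"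
    then have fx: "f x \<in> V" using \<rho>(2) by (auto simp: dist_commute)
    then have "\<forall>z\<in>T. \<exists>y. y \<in> ball z \<delta> \<and> f y = f x" by (force simp: V_def)
    \<comment> \<open>A preimage of \<open>f x\<close> is chosen in each ball. Disjointness makes
      the choice injective on \<open>T\<close>, so its range is the whole fibre of
      \<open>f x\<close> and contains \<open>x\<close>.\<close>
    then obtain y where y: "\<And>z. z \<in> T \<Longrightarrow> y z \<in> ball z \<delta>" "\<And>z. z \<in> T \<Longrightarrow> f (y z) = f x"
      by metis
    have "inj_on y T"
    proof (rule inj_onI, rule ccontr)
      fix a b assume "a \<in> T" "b \<in> T" "y a = y b" "a \<noteq> b"
      then show False
        using y(1)[of a] y(1)[of b] \<delta>(4)[of a b] ball_subset_cball by (metis disjoint_iff subsetD)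
    qed
    moreover have "y ` T \<subseteq> {z \<in> D. f z = f x}"
      using y ballD by blast
    moreover have "finite {z \<in> D. f z = f x}" "card {z \<in> D. f z = f x} \<le> card T"
      using max[of "f x"] fx by (auto simp: V_def)
    ultimately have "y ` T = {z \<in> D. f z = f x}"
      by (metis card_image card_seteq)
    then have "x \<in> y ` T" using x by simp
    then show "x \<in> (\<Union>z\<in>T. cball z \<delta>)" using y(1) ball_subset_cball by blast
  qed (rule \<rho>(1))
qed

section \<open>From properness to injectivity\<close>

text \<open>Proper maps are closed, which provides a neighbourhood of \<open>w\<close> whose
  preimages all lie in small balls around the fibre; these balls carry the sheets. Surjectivity
  follows as the image is nonempty, open and closed in the connected \<open>E\<close>.\<close>

lemma covering_space_proper_local_biholomorphism:
  assumes hf: "f holomorphic_on D" and D: "open D" and E: "open E" "connected E" and fD: "f ` D \<subseteq> E" "D \<noteq> {}"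
    and df: "\<And>z. z \<in> D \<Longrightarrow> deriv f z \<noteq> 0"
    and fin: "\<And>w. w \<in> E \<Longrightarrow> finite {z \<in> D. f z = w}"
    and proper: "\<And>K. K \<subseteq> E \<Longrightarrow> compact K \<Longrightarrow> compact (D \<inter> f -` K)"
  shows "covering_space D f E"
proof -
  have cont: "continuous_on D f" by (rule holomorphic_on_imp_continuous_on[OF hf])
  have closed_map: "closedin (top_of_set E) (f ` C)" if "closedin (top_of_set D) C" for C
    by (rule proper_map[OF that _ fD(1)]) (use proper in auto)
  have evenly: "\<exists>V. w \<in> V \<and> openin (top_of_set E) V \<and> (\<exists>v. \<Union>v = D \<inter> f -` V \<and>
      (\<forall>u\<in>v. openin (top_of_set D) u) \<and> pairwise disjnt v \<and> (\<forall>u\<in>v. \<exists>q. homeomorphism u V f q))"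
    if w: "w \<in> E" for w
  proof -
    define T where "T = {z \<in> D. f z = w}"
    have T: "finite T" "T \<subseteq> D" using fin[OF w] by (auto simp: T_def)
    have dT: "\<And>z. z \<in> T \<Longrightarrow> deriv f z \<noteq> 0" using T df by auto
    obtain \<delta> where \<delta>: "\<delta> > 0" "\<And>z. z \<in> T \<Longrightarrow> cball z \<delta> \<subseteq> D" "\<And>z. z \<in> T \<Longrightarrow> inj_on f (ball z \<delta>)"
      "\<And>z w. z \<in> T \<Longrightarrow> w \<in> T \<Longrightarrow> z \<noteq> w \<Longrightarrow> cball z \<delta> \<inter> cball w \<delta> = {}"
      using locally_injective_separated_balls[OF hf D T dT] by metis
    have ballD: "ball z \<delta> \<subseteq> D" if "z \<in> T" for z
      using \<delta>(2)[OF that] ball_subset_cball by blast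
    define C where "C = D - (\<Union>z\<in>T. ball z \<delta>)"
    \<comment> \<open>Cutting out the image of \<open>C\<close> confines the preimages of
      \<open>V\<close> to the balls, while the second factor makes every sheet map onto
      \<open>V\<close>. An empty fibre is allowed: then \<open>v\<close> is empty and
      \<open>V\<close> avoids the image of \<open>D\<close>.\<close>
    define V where "V = (E - f ` C) \<inter> (\<Inter>z\<in>T. f ` ball z \<delta>)"
    define v where "v = (\<lambda>z. ball z \<delta> \<inter> f -` V) ` T"
    have "closedin (top_of_set D) C"
      unfolding C_def using ballD by (intro closedin_diff open_subset open_UN) auto
    then have "openin (top_of_set E) (E - f ` C)"
      by (intro openin_diff closed_map) auto
    then have "open (E - f ` C)" using E(1) openin_open_eq by blast
    then have V: "open V"
      unfolding V_def using T(1) \<delta>(3) ballD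
      by (intro open_Int open_INT ballI open_mapping_thm3) (auto intro: holomorphic_on_subset[OF hf])
    have VE: "V \<subseteq> E" by (auto simp: V_def)
    have wV: "w \<in> V"
    proof -
      have "w \<in> f ` ball z \<delta>" if "z \<in> T" for z
        using that \<delta>(1) by (intro image_eqI[of _ _ z]) (auto simp: T_def)
      moreover have "w \<notin> f ` C" using \<delta>(1) by (force simp: C_def T_def)
      ultimately show ?thesis using w by (simp add: V_def)
    qed
    have ou: "open (ball z \<delta> \<inter> f -` V)" if "z \<in> T" for z
      by (rule continuous_open_preimage[OF continuous_on_subset[OF cont ballD[OF that]] open_ball V])
    have v1: "\<Union>v = D \<inter> f -` V"
    proof (intro equalityI subsetI)
      fix x assume "x \<in> D \<inter> f -` V"
      then have "x \<in> D" "f x \<in> V" by auto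
      moreover have "x \<notin> C" using \<open>f x \<in> V\<close> by (auto simp: V_def)
      ultimately show "x \<in> \<Union>v" by (auto simp: v_def C_def)
    next
      fix x assume "x \<in> \<Union>v"
      then obtain z where "z \<in> T" "x \<in> ball z \<delta>" "f x \<in> V" by (auto simp: v_def)
      then show "x \<in> D \<inter> f -` V" using ballD by blast
    qed
    have v2: "openin (top_of_set D) u" if "u \<in> v" for u
      using that ou ballD by (auto simp: v_def intro!: open_subset)
    have v3: "pairwise disjnt v"
    proof -
      have "disjnt (ball z \<delta> \<inter> f -` V) (ball z' \<delta> \<inter> f -` V)" if "z \<in> T" "z' \<in> T" "z \<noteq> z'" for z z'
      proof -
        have "disjnt (cball z \<delta>) (cball z' \<delta>)" using \<delta>(4)[OF that] by (simp only: disjnt_def)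
        then show ?thesis
          by (rule disjnt_subset2[OF disjnt_subset1]) auto
      qed
      then show ?thesis unfolding v_def pairwise_image pairwise_def by blast
    qed
    have v4: "\<exists>q. homeomorphism u V f q" if u: "u \<in> v" for u
    proof -
      obtain z where z: "z \<in> T" "u = ball z \<delta> \<inter> f -` V" using u unfolding v_def by blast
      have "f ` u = V"
      proof (intro equalityI subsetI)
        fix y assume "y \<in> V"
        moreover from this obtain x where "x \<in> ball z \<delta>" "y = f x"
          using z(1) unfolding V_def by blast
        ultimately show "y \<in> f ` u" using z(2) by blast
      qed (use z(2) in blast)
      moreover have "continuous_on u f"
        by (rule continuous_on_subset[OF cont]) (use ballD z in blast)
      moreover have "inj_on f u"
        by (rule inj_on_subset[OF \<delta>(3)[OF z(1)]]) (use z(2) in blast)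
      moreover have "open u"
        unfolding z(2) by (rule ou[OF z(1)])
      ultimately show ?thesis using invariance_of_domain_homeomorphism[of u f] by blast
    qed
    show ?thesis
      by (intro exI[of _ V] exI[of _ v] conjI ballI wV open_subset[OF VE V] v1 v2 v3 v4)
  qed
  have "f ` D = E"
  proof -
    have "openin (top_of_set E) (f ` D)"
    proof (subst openin_subopen, intro ballI)
      fix y assume "y \<in> f ` D"
      then obtain z where z: "z \<in> D" "y = f z" by auto
      obtain r where r: "r > 0" "ball z r \<subseteq> D" "inj_on f (ball z r)"
        using has_complex_derivative_locally_injective[OF hf z(1) D df[OF z(1)]] by blast
      have "open (f ` ball z r)"
        using r by (intro open_mapping_thm3) (auto intro: holomorphic_on_subset[OF hf])
      then show "\<exists>T. openin (top_of_set E) T \<and> y \<in> T \<and> T \<subseteq> f ` D"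
        using r z fD by (intro exI[of _ "f ` ball z r"]) (auto intro!: open_subset)
    qed
    moreover have "closedin (top_of_set E) (f ` D)"
      by (rule closed_map) simp
    ultimately show ?thesis using E(2) fD unfolding connected_clopen by blast
  qed
  with cont evenly show ?thesis by (simp add: covering_space_def)
qed

text \<open>The identity of the simply connected \<open>S\<close> lifts to a section
  \<open>s\<close>. Then \<open>s\<close> after \<open>p\<close> and the identity of
  \<open>C\<close> are two lifts of \<open>p\<close> on the connected \<open>C\<close>; agreeing at
  one point they coincide, so \<open>s\<close> is a left inverse of \<open>p\<close>.\<close>

lemma covering_space_simply_connected_inj:
  fixes p :: "'a::real_normed_vector \<Rightarrow> 'b::real_normed_vector"
  assumes cov: "covering_space C p S" and C: "connected C"
    and S: "simply_connected S" "locally path_connected S"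
  shows "inj_on p C"
proof -
  have cont: "continuous_on C p" and im: "p ` C = S"
    using covering_space_imp_continuous[OF cov] covering_space_imp_surjective[OF cov] .
  obtain s where s: "continuous_on S s" "s \<in> S \<rightarrow> C" "\<And>y. y \<in> S \<Longrightarrow> p (s y) = y"
    using covering_space_lift[OF cov S continuous_on_id] by auto
  have "s (p x) = x" if x: "x \<in> C" for x
  proof -
    \<comment> \<open>At this point the two lifts agree, because \<open>s\<close> is a section of
      \<open>p\<close>.\<close>
    define a where "a = s (p x)"
    have a: "a \<in> C" using s x im by (auto simp: a_def)
    have sp: "continuous_on C (\<lambda>x. s (p x))"
      by (rule continuous_on_compose2[OF s(1) cont]) (use im in auto)
    have "s (p a) = a" using s x im by (auto simp: a_def)
    then show ?thesis
      by (rule covering_space_lift_unique[where f = p and ?g1.0 = "\<lambda>x. s (p x)" and ?g2.0 = "\<lambda>x. x",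
            OF cov _ cont _ sp _ _ continuous_on_id _ _ C a x])
        (use im s(2,3) in auto)
  qed
  then show ?thesis by (rule inj_on_inverseI)
qed

section \<open>Assembling the proof\<close>

theorem theorem3p1:
  fixes f :: "complex \<Rightarrow> complex"
  assumes "f holomorphic_on unit_disc" and "f ` unit_disc \<subseteq> unit_disc"
    and "f \<in> V_F"
    and "\<forall>z\<in>unit_disc. deriv f z \<noteq> 0"
    and "inner_function f"
  shows "f \<in> Aut_disc"
proof -
  note hf = assms(1)
  have f1: "cmod (f z) < 1" if "cmod z < 1" for z
    using assms(2) that by (auto simp: image_subset_iff)
  obtain N where N: "\<And>w. w \<in> unit_disc \<Longrightarrow> finite {z \<in> unit_disc. f z = w} \<and> card {z \<in> unit_disc. f z = w} \<le> N"
    using assms(3) unfolding V_F_def by blast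
  define fibre where "fibre w = {z \<in> unit_disc. f z = w}" for w
  \<comment> \<open>All fibre sizes lie below \<open>Suc N\<close>, so a maximum is attained; the
    witness 0 merely shows that the disc is nonempty.\<close>
  have "\<exists>w. w \<in> unit_disc \<and> (\<forall>v. v \<in> unit_disc \<longrightarrow> card (fibre v) \<le> card (fibre w))"
    by (rule ex_has_greatest_nat[of _ 0 _ "Suc N"]) (use N in \<open>auto simp: fibre_def less_Suc_eq_le\<close>)
  then obtain w where w: "w \<in> unit_disc" and wmax: "\<And>v. v \<in> unit_disc \<Longrightarrow> card (fibre v) \<le> card (fibre w)"
    by blast
  obtain \<rho> K where K: "\<rho> > 0" "compact K" "K \<subseteq> unit_disc"
    "\<And>z. z \<in> unit_disc \<Longrightarrow> dist (f z) w < \<rho> \<Longrightarrow> z \<in> K"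
  proof (rule compact_preimage_near_maximal_fibre[OF hf open_ball])
    show "fibre w = {z \<in> unit_disc. f z = w}" by (simp add: fibre_def)
    show "finite (fibre w)" using N[OF w] by (simp add: fibre_def)
    show "deriv f z \<noteq> 0" if "z \<in> fibre w" for z using that assms(4) by (auto simp: fibre_def)
    show "finite {z \<in> unit_disc. f z = v} \<and> card {z \<in> unit_disc. f z = v} \<le> card (fibre w)"
      if "v \<in> unit_disc" for v
      using N[OF that] wmax[OF that] by (simp add: fibre_def)
  qed (use w in \<open>auto intro: that\<close>)
  \<comment> \<open>The compact \<open>K\<close> stays inside a smaller closed disc, and outside it
    \<open>f\<close> keeps distance \<open>\<rho>\<close> from \<open>w\<close>.\<close>
  have "\<forall>\<^sub>F z in disc_bdry. \<rho> \<le> cmod (f z - w)"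
  proof -
    have "\<exists>b<1. \<forall>z\<in>K. cmod z \<le> b"
    proof (cases "K = {}")
      case True
      then show ?thesis by (intro exI[of _ 0]) auto
    next
      case False
      then obtain x where "x \<in> K" "\<forall>z\<in>K. cmod z \<le> cmod x"
        using continuous_attains_sup[OF K(2), of cmod] continuous_on_norm_id by blast
      then show ?thesis using K(3) by (intro exI[of _ "cmod x"]) auto
    qed
    then obtain b where b: "b < 1" "\<And>z. z \<in> K \<Longrightarrow> cmod z \<le> b" by blast
    show ?thesis
      unfolding eventually_disc_bdry
    proof (intro exI[of _ b] conjI allI impI)
      fix z assume "b < cmod z" "cmod z < 1"
      then show "\<rho> \<le> cmod (f z - w)"
        using b(2)[of z] K(4)[of z] by (force simp: dist_norm)
    qed (rule b(1))
  qed
  then have bdry: "((\<lambda>z. cmod (f z)) \<longlongrightarrow> 1) disc_bdry"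
    using inner_function_tendsto_boundary[OF hf f1, of w \<rho>] assms(4,5) w N[OF w] K(1)
    by (auto simp: inner_function_def)
  \<comment> \<open>Near the circle the modulus of \<open>f\<close> exceeds every modulus in
    \<open>L\<close>, so the preimage of \<open>L\<close> lies in a smaller closed disc, where it is
    closed.\<close>
  have proper: "compact (unit_disc \<inter> f -` L)" if L: "L \<subseteq> unit_disc" "compact L" for L
  proof (cases "L = {}")
    case False
    then obtain x where x: "x \<in> L" "\<forall>y\<in>L. cmod y \<le> cmod x"
      using continuous_attains_sup[OF L(2), of cmod] continuous_on_norm_id by blast
    have "\<forall>\<^sub>F z in disc_bdry. cmod x < cmod (f z)"
      by (rule order_tendstoD(1)[OF bdry]) (use x L in auto)
    then obtain b where b: "b < 1" "\<And>z. b < cmod z \<Longrightarrow> cmod z < 1 \<Longrightarrow> cmod x < cmod (f z)"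
      unfolding eventually_disc_bdry by blast
    then have "unit_disc \<inter> f -` L = cball 0 b \<inter> f -` L"
    proof (intro equalityI subsetI)
      fix z assume "z \<in> unit_disc \<inter> f -` L"
      then show "z \<in> cball 0 b \<inter> f -` L"
        using x(2) b(2)[of z] by (auto simp: not_less[symmetric])
    qed (use b(1) in auto)
    moreover have "closed (cball 0 b \<inter> f -` L)"
      using b(1) L(2)
      by (intro continuous_closed_preimage holomorphic_on_imp_continuous_on holomorphic_on_subset[OF hf])
        (auto intro: compact_imp_closed)
    then have "compact (cball 0 b \<inter> f -` L)"
      using bounded_subset[OF bounded_cball[of 0 b]] by (auto simp: compact_eq_bounded_closed)
    ultimately show ?thesis by simp
  qed auto
  have cov: "covering_space unit_disc f unit_disc"
    by (rule covering_space_proper_local_biholomorphism[OF hf])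
      (use assms N proper in auto)
  have inj: "inj_on f unit_disc"
    by (rule covering_space_simply_connected_inj[OF cov])
      (auto intro: convex_imp_simply_connected convex_imp_locally_path_connected)
  have im: "f ` unit_disc = unit_disc"
    using cov by (rule covering_space_imp_surjective)
  \<comment> \<open>The inverse is again a holomorphic self-map of the disc, so the biholomorphic
    characterisation, which rests on the Schwarz lemma, yields the Moebius form.\<close>
  obtain g where g: "g holomorphic_on unit_disc" "\<And>z. z \<in> unit_disc \<Longrightarrow> g (f z) = z"
    using holomorphic_has_inverse[OF hf open_ball inj] im by metis
  have "g z \<in> unit_disc \<and> f (g z) = z" if "z \<in> unit_disc" for z
    using that g(2) im by (metis imageE)
  then have "g \<in> holo_self_maps" "\<forall>z\<in>unit_disc. g (f z) = z \<and> f (g z) = z"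
    using g by (auto simp: holo_self_maps_def)
  then show ?thesis
    unfolding Aut_disc_iff_biholomorphic using assms(1,2) by (auto simp: holo_self_maps_def)
qed

end
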